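(* Let $\alpha\in(0,1)$, $\rho,\mu,\lambda>0$ and $0<\beta<\alpha$. Then the generalized fractional negative binomial process $\{\mathcal{G}(t)\}_{t\ge 0}$, $\mathcal{G}(t)=N_\beta(M(t),\lambda)$, exhibits overdispersion, that is, $$\operatorname{Var}[\mathcal{G}(t)]-\mathbb{E}[\mathcal{G}(t)]>0\quad\text{for all } t>0.$$
   Context: Fractional Poisson process (FPP): for $0<\beta<1$, let $\{S_\beta(t)\}_{t\ge0}$ be the $\beta$-stable subordinator with $\mathbb{E}[e^{-uS_\beta(t)}]=e^{-tu^\beta}$, and let $E_\beta(t)=\inf\{r\ge 0: S_\beta(r)>t\}$ be its inverse. The FPP with parameter $\lambda>0$ is $N_\beta(t,\lambda)=N(E_\beta(t),\lambda)$, where $\{N(t,\lambda)\}_{t\ge0}$ is a homogeneous Poisson process of rate $\lambda$ independent of $E_\beta$. Mittag-Leffler (ML) Lévy subordinator: for $\alpha\in(0,1)$ and $\rho,\mu>0$, $M(t)=M_{\alpha,\rho,\mu}(t)$ is the non-decreasing Lévy process with $M(0)=0$ and $\mathbb{E}[e^{-uM(t)}]=\left(\frac{\mu}{\mu+u^\alpha}\right)^{\rho t}$, $u\ge 0$. Generalized fractional negative binomial process (GFNBP): $\mathcal{G}(t)=\mathcal{G}_{\alpha,\rho}^{\mu,\beta}(t,\lambda):=N_\beta(M_{\alpha,\rho,\mu}(t),\lambda)$, $t\ge 0$, where $M$ is independent of $N_\beta$. *)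

theory Defs
  imports "HOL-Probability.Probability"
begin

text \<open>
  A process is a function of time and outcome; only its values at times \<open>t \<ge> 0\<close> matter.
  Path regularity and the value at time 0 are required for every outcome, not just almost
  surely, so that processes evaluated at random times are random variables.
\<close>

definition levy_process :: "'a measure \<Rightarrow> (real \<Rightarrow> 'a \<Rightarrow> real) \<Rightarrow> bool" where
  "levy_process P X \<longleftrightarrow>
     (\<forall>t\<ge>0. X t \<in> borel_measurable P) \<and>
     (\<forall>\<omega>\<in>space P. X 0 \<omega> = 0) \<and>
     (\<forall>(n::nat) (t::nat \<Rightarrow> real). 0 \<le> t 0 \<and> (\<forall>i<n. t i \<le> t (Suc i)) \<longrightarrow>
        prob_space.indep_vars P (\<lambda>_. borel) (\<lambda>i \<omega>. X (t (Suc i)) \<omega> - X (t i) \<omega>) {..<n}) \<and>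
     (\<forall>s\<ge>0. \<forall>h\<ge>0. distr P borel (\<lambda>\<omega>. X (s + h) \<omega> - X s \<omega>) = distr P borel (X h)) \<and>
     (\<forall>\<omega>\<in>space P. \<forall>t\<ge>0. continuous (at_right t) (\<lambda>s. X s \<omega>)) \<and>
     (\<forall>\<omega>\<in>space P. \<forall>t>0. \<exists>l. ((\<lambda>s. X s \<omega>) \<longlongrightarrow> l) (at_left t))"

definition subordinator :: "'a measure \<Rightarrow> (real \<Rightarrow> 'a \<Rightarrow> real) \<Rightarrow> bool" where
  "subordinator P X \<longleftrightarrow>
     levy_process P X \<and> (\<forall>\<omega>\<in>space P. mono_on {0..} (\<lambda>t. X t \<omega>))"

definition stable_subordinator :: "'a measure \<Rightarrow> real \<Rightarrow> (real \<Rightarrow> 'a \<Rightarrow> real) \<Rightarrow> bool" where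
  "stable_subordinator P \<beta> S \<longleftrightarrow>
     subordinator P S \<and>
     (\<forall>t\<ge>0. \<forall>u\<ge>0. (\<integral>\<omega>. exp (- u * S t \<omega>) \<partial>P) = exp (- t * u powr \<beta>))"

definition mittag_leffler_subordinator ::
    "'a measure \<Rightarrow> real \<Rightarrow> real \<Rightarrow> real \<Rightarrow> (real \<Rightarrow> 'a \<Rightarrow> real) \<Rightarrow> bool" where
  "mittag_leffler_subordinator P \<alpha> \<rho> \<mu> M \<longleftrightarrow>
     subordinator P M \<and>
     (\<forall>t\<ge>0. \<forall>u\<ge>0. (\<integral>\<omega>. exp (- u * M t \<omega>) \<partial>P) = (\<mu> / (\<mu> + u powr \<alpha>)) powr (\<rho> * t))"

definition poisson_process :: "'a measure \<Rightarrow> real \<Rightarrow> (real \<Rightarrow> 'a \<Rightarrow> real) \<Rightarrow> bool" where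
  "poisson_process P r N \<longleftrightarrow>
     subordinator P N \<and>
     (\<forall>\<omega>\<in>space P. \<forall>t\<ge>0. N t \<omega> \<in> \<nat>) \<and>
     (\<forall>t\<ge>0. \<forall>k::nat. measure P {\<omega> \<in> space P. N t \<omega> = real k} = (r * t) ^ k / fact k * exp (- (r * t)))"

text \<open>
  The first-passage set is nonempty almost surely for a stable subordinator; the value 0 on
  the exceptional null event replaces the unspecified real \<open>Inf {}\<close>.
\<close>

definition inverse_subordinator :: "(real \<Rightarrow> 'a \<Rightarrow> real) \<Rightarrow> real \<Rightarrow> 'a \<Rightarrow> real" where
  "inverse_subordinator S t \<omega> =
     (if \<exists>r\<ge>0. S r \<omega> > t then Inf {r. 0 \<le> r \<and> S r \<omega> > t} else 0)"

text \<open>Independence of whole processes, as random elements of the path space.\<close>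

definition indep_processes ::
    "'a measure \<Rightarrow> (real \<Rightarrow> 'a \<Rightarrow> real) \<Rightarrow> (real \<Rightarrow> 'a \<Rightarrow> real) \<Rightarrow> bool" where
  "indep_processes P X Y \<longleftrightarrow>
     prob_space.indep_var P
       (PiM {0..} (\<lambda>_. borel)) (\<lambda>\<omega>. \<lambda>t\<in>{0..}. X t \<omega>)
       (PiM {0..} (\<lambda>_. borel)) (\<lambda>\<omega>. \<lambda>t\<in>{0..}. Y t \<omega>)"

definition time_change :: "(real \<Rightarrow> 'a \<Rightarrow> real) \<Rightarrow> (real \<Rightarrow> 'a \<Rightarrow> real) \<Rightarrow> real \<Rightarrow> 'a \<Rightarrow> real" where
  "time_change X T t \<omega> = X (T t \<omega>) \<omega>"

definition fpp :: "(real \<Rightarrow> 'a \<Rightarrow> real) \<Rightarrow> (real \<Rightarrow> 'a \<Rightarrow> real) \<Rightarrow> real \<Rightarrow> 'a \<Rightarrow> real" where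
  "fpp N S = time_change N (inverse_subordinator S)"

definition gfnbp ::
    "(real \<Rightarrow> 'a \<Rightarrow> real) \<Rightarrow> (real \<Rightarrow> 'a \<Rightarrow> real) \<Rightarrow> (real \<Rightarrow> 'a \<Rightarrow> real) \<Rightarrow> real \<Rightarrow> 'a \<Rightarrow> real" where
  "gfnbp N S M = time_change (fpp N S) M"

text \<open>
  Variance with values in \<open>[0, \<infinity>]\<close>. The library's \<open>variance\<close> is a Bochner integral and hence 0
  when the second moment is infinite, which happens for the generalized fractional negative
  binomial process when \<open>\<alpha> \<le> 2 * \<beta>\<close>.
\<close>

definition ext_variance :: "'a measure \<Rightarrow> ('a \<Rightarrow> real) \<Rightarrow> ereal" where
  "ext_variance P X = enn2ereal (\<integral>\<^sup>+\<omega>. ennreal ((X \<omega> - (\<integral>\<omega>'. X \<omega>' \<partial>P))\<^sup>2) \<partial>P)"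

lemma (in prob_space) ext_variance_eq_variance:
  assumes "integrable M X" "integrable M (\<lambda>\<omega>. (X \<omega>)\<^sup>2)"
  shows "ext_variance M X = ereal (variance X)"
proof -
  have "integrable M (\<lambda>\<omega>. (X \<omega> - expectation X)\<^sup>2)"
    using assms by (simp add: power2_diff)
  then show ?thesis
    by (simp add: ext_variance_def nn_integral_eq_integral)
qed

end

theory Submission
  imports Defs
begin

text \<open>
  Write \<open>E\<close> for the inverse stable subordinator, so that the process at time \<open>t\<close> is
  \<open>G = N (E (M t))\<close>. For a fixed time \<open>s\<close> and given \<open>E s\<close>, the variable \<open>N (E s)\<close> is Poisson with
  mean \<open>r * E s\<close>, and for every centre \<open>c\<close> a Poisson variable with mean \<open>m\<close> has
  \<open>m + (m - c)\<^sup>2\<close> as its second moment about \<open>c\<close>. Take \<open>c\<close> to be the mean of \<open>G\<close>, average over \<open>E s\<close>,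
  and then average over \<open>s\<close> with the law of \<open>M t\<close>: the variance of \<open>G\<close> is its mean plus the double
  average of \<open>(r * E s - c)\<^sup>2\<close>. This holds in \<open>[0, \<infinity>]\<close>, so it covers finite and infinite variance
  at once. The double average is positive because \<open>E s\<close> is not almost surely constant for any
  \<open>s > 0\<close> (\<open>inverse_stable_not_AE_const\<close>) and \<open>M t\<close> is positive with positive probability
  (\<open>mittag_leffler_not_AE_zero\<close>). The two averages are kept as iterated integrals over two separate
  outcomes, since \<open>M\<close> is independent of the process \<open>N (E s)\<close> but not necessarily of \<open>E\<close>.

  The difference of variance and mean is meaningful because the mean is finite: the expectation of
  \<open>E s\<close> grows at most like \<open>(1 + s) powr \<beta>\<close> (\<open>inverse_stable_mean_bound\<close>), and \<open>M t\<close> has a finite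
  moment of order \<open>\<beta> < \<alpha>\<close> (\<open>mittag_leffler_moment_finite\<close>). Both bounds come from the Laplace
  transforms, through pathwise comparison with series of exponentials.

  Conditioning is justified by \<open>indep_time_change\<close>, applied once to \<open>N\<close> at the time \<open>E s\<close> and once
  to the fractional Poisson process at the time \<open>M t\<close>. It needs joint measurability in time and
  outcome, which follows from right-continuity of the paths; for the fractional Poisson process
  this is \<open>right_continuous_fpp\<close>.
\<close>

section \<open>Right-continuous processes at independent random times\<close>

lemma (in prob_space) indep_set_sym:
  assumes "indep_set A B"
  shows "indep_set B A"
proof -
  have "prob (b \<inter> a) = prob b * prob a" if "a \<in> A" "b \<in> B" for a b
    using indep_setD[OF assms that] by (simp add: Int_commute mult.commute)
  then show ?thesis
    using assms by (simp add: indep_sets2_eq)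
qed

lemma indep_processes_sym:
  assumes "prob_space P" and "indep_processes P X Y"
  shows "indep_processes P Y X"
  using assms unfolding indep_processes_def prob_space.indep_var_eq[OF assms(1)]
  by (blast intro: prob_space.indep_set_sym)

lemma indep_processes_measurable:
  assumes "prob_space P" and "indep_processes P X Y"
  shows "(\<lambda>\<omega>. \<lambda>t\<in>{0..}. Y t \<omega>) \<in> measurable P (PiM {0..} (\<lambda>_. borel))"
    and "0 \<le> t \<Longrightarrow> Y t \<in> borel_measurable P"
proof -
  show path: "(\<lambda>\<omega>. \<lambda>t\<in>{0..}. Y t \<omega>) \<in> measurable P (PiM {0..} (\<lambda>_. borel))"
    using assms(2) unfolding indep_processes_def prob_space.indep_var_eq[OF assms(1)] by simp
  assume "0 \<le> t"
  then have "t \<in> {0..}" by simp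
  from measurable_compose[OF path measurable_component_singleton[OF this]] \<open>0 \<le> t\<close>
  show "Y t \<in> borel_measurable P" by simp
qed

text \<open>
  The approximation from the right with mesh \<open>1 / Suc n\<close>. The maximum with 0
  keeps it inside the index set of the path space for every real \<open>s\<close>.
\<close>

definition grid_above :: "nat \<Rightarrow> real \<Rightarrow> real" where
  "grid_above n s = max 0 ((of_int \<lfloor>s * real (Suc n)\<rfloor> + 1) / real (Suc n))"

lemma grid_above_nonneg: "0 \<le> grid_above n s"
  by (simp add: grid_above_def)

lemma filterlim_grid_above:
  assumes "0 \<le> s"
  shows "filterlim (\<lambda>n. grid_above n s) (at_right s) sequentially"
proof -
  have lo: "s < grid_above n s" for n
  proof -
    have "s * real (Suc n) < of_int \<lfloor>s * real (Suc n)\<rfloor> + 1"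
      by linarith
    then have "s < (of_int \<lfloor>s * real (Suc n)\<rfloor> + 1) / real (Suc n)"
      by (simp only: pos_less_divide_eq of_nat_0_less_iff zero_less_Suc)
    then show ?thesis
      by (simp add: grid_above_def)
  qed
  have hi: "grid_above n s \<le> s + inverse (real (Suc n))" for n
  proof -
    have "of_int \<lfloor>s * real (Suc n)\<rfloor> + 1 \<le> s * real (Suc n) + 1"
      by simp
    then have "(of_int \<lfloor>s * real (Suc n)\<rfloor> + 1) / real (Suc n) \<le> (s * real (Suc n) + 1) / real (Suc n)"
      by (intro divide_right_mono) auto
    also have "\<dots> = s + inverse (real (Suc n))"
      by (simp add: field_simps)
    finally show ?thesis
      using assms by (auto simp: grid_above_def)
  qed
  have "(\<lambda>n. grid_above n s) \<longlonglongrightarrow> s"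
  proof (rule tendsto_sandwich[OF always_eventually always_eventually tendsto_const])
    show "(\<lambda>n. s + inverse (real (Suc n))) \<longlonglongrightarrow> s"
      using tendsto_add[OF tendsto_const LIMSEQ_inverse_real_of_nat, of s] by simp
  qed (intro allI less_imp_le[OF lo] hi)+
  with lo show ?thesis
    by (auto simp: filterlim_at intro!: always_eventually) (metis less_irrefl)
qed

text \<open>
  Evaluating a path at a variable time is not measurable on the product space of all paths. The
  limit along countably many grid times is, and it agrees with evaluation at every point of
  right-continuity.
\<close>

definition path_eval :: "real \<times> (real \<Rightarrow> real) \<Rightarrow> real" where
  "path_eval = (\<lambda>(s, x). lim (\<lambda>n. x (grid_above n s)))"

lemma measurable_path_eval:
  "path_eval \<in> borel_measurable (borel \<Otimes>\<^sub>M PiM {0..} (\<lambda>_. borel))"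
proof -
  let ?B = "borel \<Otimes>\<^sub>M PiM {0..} (\<lambda>_. borel) :: (real \<times> (real \<Rightarrow> real)) measure"
  have "(\<lambda>p. snd p (grid_above n (fst p))) \<in> borel_measurable ?B" for n
  proof -
    \<comment> \<open>The \<open>n\<close>-th approximation reads only countably many coordinates, selected by an integer.\<close>
    let ?q = "\<lambda>i::int. max 0 ((of_int i + 1) / real (Suc n))"
    have "(\<lambda>p. snd p (?q i)) \<in> borel_measurable ?B" for i
      by (rule measurable_compose[OF measurable_snd measurable_component_singleton]) simp
    moreover have "(\<lambda>p. \<lfloor>fst p * real (Suc n)\<rfloor>) \<in> measurable ?B (count_space UNIV)"
      by (rule measurable_compose[OF measurable_fst[of borel]]) measurable
    ultimately have "(\<lambda>p. snd p (?q \<lfloor>fst p * real (Suc n)\<rfloor>)) \<in> borel_measurable ?B"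
      by (rule measurable_compose_countable)
    then show ?thesis
      by (simp add: grid_above_def)
  qed
  then show ?thesis
    unfolding path_eval_def split_beta by (rule borel_measurable_lim_metric)
qed

lemma path_eval_eq:
  assumes "0 \<le> s" and "continuous (at_right s) x"
  shows "path_eval (s, restrict x {0..}) = x s"
proof -
  have "(x \<longlongrightarrow> x s) (at_right s)"
    using assms(2) by (simp add: continuous_within)
  then have "(\<lambda>n. x (grid_above n s)) \<longlonglongrightarrow> x s"
    using filterlim_grid_above[OF assms(1)] by (rule filterlim_compose)
  then show ?thesis
    by (simp add: path_eval_def grid_above_nonneg limI)
qed

definition right_continuous_paths :: "'a measure \<Rightarrow> (real \<Rightarrow> 'a \<Rightarrow> real) \<Rightarrow> bool" where
  "right_continuous_paths P X \<longleftrightarrow>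
     (\<forall>\<omega>\<in>space P. \<forall>t\<ge>0. continuous (at_right t) (\<lambda>s. X s \<omega>))"

lemma measurable_process_pair:
  assumes "right_continuous_paths P X"
    and path: "(\<lambda>\<omega>. \<lambda>t\<in>{0..}. X t \<omega>) \<in> measurable P (PiM {0..} (\<lambda>_. borel))"
    and T: "T \<in> borel_measurable Q" "\<And>\<omega>. \<omega> \<in> space Q \<Longrightarrow> 0 \<le> T \<omega>"
  shows "(\<lambda>(\<omega>', \<omega>). X (T \<omega>') \<omega>) \<in> borel_measurable (Q \<Otimes>\<^sub>M P)"
proof -
  have "(\<lambda>(\<omega>', \<omega>). path_eval (T \<omega>', \<lambda>t\<in>{0..}. X t \<omega>)) \<in> borel_measurable (Q \<Otimes>\<^sub>M P)"
    unfolding split_beta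
    by (rule measurable_compose[OF _ measurable_path_eval])
       (intro measurable_Pair measurable_compose[OF measurable_fst T(1)]
          measurable_compose[OF measurable_snd path])
  also have "?this \<longleftrightarrow> ?thesis"
    using assms(1) T(2)
    by (intro measurable_cong)
       (auto simp: space_pair_measure right_continuous_paths_def path_eval_eq)
  finally show ?thesis .
qed

text \<open>
  Conditioning on the random time: by the joint measurability of path evaluation, a process read at
  an independent time is a measurable function of a pair whose law is a product, so Tonelli's theorem
  applies.
\<close>

lemma (in prob_space) indep_time_change:
  assumes rc: "right_continuous_paths M X"
    and ind: "indep_processes M Y X"
    and "0 \<le> t" and T: "\<And>\<omega>. \<omega> \<in> space M \<Longrightarrow> 0 \<le> Y t \<omega>"
  shows "(\<lambda>\<omega>. X (Y t \<omega>) \<omega>) \<in> borel_measurable M"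
    and "f \<in> borel_measurable borel \<Longrightarrow>
      (\<integral>\<^sup>+\<omega>. f (X (Y t \<omega>) \<omega>) \<partial>M) = (\<integral>\<^sup>+\<omega>'. \<integral>\<^sup>+\<omega>. f (X (Y t \<omega>') \<omega>) \<partial>M \<partial>M)"
proof -
  let ?L = "PiM {0..} (\<lambda>_. borel) :: (real \<Rightarrow> real) measure"
  let ?p = "\<lambda>\<omega>. \<lambda>s\<in>{0..}. X s \<omega>" and ?q = "\<lambda>\<omega>. \<lambda>s\<in>{0..}. Y s \<omega>"
  note [measurable] = measurable_path_eval
  have mq[measurable]: "?q \<in> measurable M ?L" and mp[measurable]: "?p \<in> measurable M ?L"
    and joint: "distr M ?L ?q \<Otimes>\<^sub>M distr M ?L ?p = distr M (?L \<Otimes>\<^sub>M ?L) (\<lambda>\<omega>. (?q \<omega>, ?p \<omega>))"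
    using ind unfolding indep_processes_def indep_var_distribution_eq by blast+
  have "t \<in> {0..}"
    using \<open>0 \<le> t\<close> by simp
  then have proj[measurable]: "(\<lambda>y. y t) \<in> borel_measurable ?L"
    by (rule measurable_component_singleton)
  have eval: "path_eval (?q \<omega>' t, ?p \<omega>) = X (Y t \<omega>') \<omega>" if "\<omega> \<in> space M" "\<omega>' \<in> space M" for \<omega> \<omega>'
    using that rc T \<open>0 \<le> t\<close> by (simp add: path_eval_eq right_continuous_paths_def)
  have "(\<lambda>\<omega>. path_eval (?q \<omega> t, ?p \<omega>)) \<in> borel_measurable M"
    by (rule measurable_compose[OF _ measurable_path_eval])
       (intro measurable_Pair measurable_compose[OF mq proj] mp)
  also have "?this \<longleftrightarrow> (\<lambda>\<omega>. X (Y t \<omega>) \<omega>) \<in> borel_measurable M"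
    using eval by (intro measurable_cong) simp
  finally show "(\<lambda>\<omega>. X (Y t \<omega>) \<omega>) \<in> borel_measurable M" .
  assume f[measurable]: "f \<in> borel_measurable borel"
  interpret D: prob_space "distr M ?L ?p"
    by (rule prob_space_distr) measurable
  have F: "(\<lambda>z. f (path_eval (fst z t, snd z))) \<in> borel_measurable (?L \<Otimes>\<^sub>M ?L)"
    by (intro measurable_compose[OF _ f] measurable_compose[OF _ measurable_path_eval]
          measurable_Pair measurable_compose[OF measurable_fst proj] measurable_snd)
  have "(\<integral>\<^sup>+\<omega>. f (X (Y t \<omega>) \<omega>) \<partial>M) = (\<integral>\<^sup>+\<omega>. f (path_eval (?q \<omega> t, ?p \<omega>)) \<partial>M)"
    using eval by (intro nn_integral_cong) simp
  also have "\<dots> = (\<integral>\<^sup>+z. f (path_eval (fst z t, snd z)) \<partial>(distr M ?L ?q \<Otimes>\<^sub>M distr M ?L ?p))"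
    unfolding joint using F by (subst nn_integral_distr) auto
  also have "\<dots> = (\<integral>\<^sup>+y. \<integral>\<^sup>+x. f (path_eval (y t, x)) \<partial>distr M ?L ?p \<partial>distr M ?L ?q)"
    using D.nn_integral_fst[of "\<lambda>z. f (path_eval (fst z t, snd z))" "distr M ?L ?q"] F by simp
  also have "\<dots> = (\<integral>\<^sup>+\<omega>'. \<integral>\<^sup>+x. f (path_eval (?q \<omega>' t, x)) \<partial>distr M ?L ?p \<partial>M)"
    using D.borel_measurable_nn_integral[of "\<lambda>y x. f (path_eval (y t, x))" ?L] F
    by (subst nn_integral_distr) (auto simp: split_beta)
  also have "\<dots> = (\<integral>\<^sup>+\<omega>'. \<integral>\<^sup>+\<omega>. f (X (Y t \<omega>') \<omega>) \<partial>M \<partial>M)"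
  proof (rule nn_integral_cong)
    fix \<omega>' assume w: "\<omega>' \<in> space M"
    have "(\<lambda>x. path_eval (?q \<omega>' t, x)) \<in> borel_measurable ?L"
      by (rule measurable_compose[OF measurable_Pair1' measurable_path_eval]) simp
    then have "(\<lambda>x. f (path_eval (?q \<omega>' t, x))) \<in> borel_measurable ?L"
      by measurable
    then show "(\<integral>\<^sup>+x. f (path_eval (?q \<omega>' t, x)) \<partial>distr M ?L ?p) = (\<integral>\<^sup>+\<omega>. f (X (Y t \<omega>') \<omega>) \<partial>M)"
      using eval[OF _ w] by (subst nn_integral_distr) (auto intro!: nn_integral_cong)
  qed
  finally show "(\<integral>\<^sup>+\<omega>. f (X (Y t \<omega>) \<omega>) \<partial>M) = (\<integral>\<^sup>+\<omega>'. \<integral>\<^sup>+\<omega>. f (X (Y t \<omega>') \<omega>) \<partial>M \<partial>M)" .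
qed

section \<open>Moments of the Poisson process\<close>

text \<open>
  The second moment is taken about an arbitrary centre \<open>c\<close>: later \<open>c\<close> is the mean of a mixture and
  not of the individual Poisson law. It is assembled from the factorial moments 1, \<open>y\<close>, \<open>y\<^sup>2\<close>, each of
  which is the previous series shifted by one index.
\<close>

lemma sums_poisson_moments:
  fixes y c :: real
  shows "(\<lambda>k. real k * (y ^ k / fact k * exp (- y))) sums y"
    and "(\<lambda>k. (real k - c)\<^sup>2 * (y ^ k / fact k * exp (- y))) sums (y + (y - c)\<^sup>2)"
proof -
  let ?p = "\<lambda>k. y ^ k / fact k * exp (- y)"
  have p0: "?p sums 1"
    using sums_mult2[OF exp_converges[of y], of "exp (- y)"]
    by (simp add: exp_minus divide_inverse mult_ac)
  have "(\<lambda>k. real (Suc k) * ?p (Suc k)) sums y"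
    using sums_mult[OF p0, of y] by (simp add: field_simps del: of_nat_Suc)
  then show p1: "(\<lambda>k. real k * ?p k) sums y"
    using sums_Suc_iff[of "\<lambda>k. real k * ?p k" y] by simp
  have "real (Suc k) * (real (Suc k) - 1) * ?p (Suc k) = y * (real k * ?p k)" for k
    by (simp add: field_simps del: of_nat_Suc) (simp add: field_simps)
  then have "(\<lambda>k. real (Suc k) * (real (Suc k) - 1) * ?p (Suc k)) sums (y * y)"
    using sums_mult[OF p1, of y] by presburger
  then have p2: "(\<lambda>k. real k * (real k - 1) * ?p k) sums (y * y)"
    using sums_Suc_iff[of "\<lambda>k. real k * (real k - 1) * ?p k" "y * y"] by simp
  have sq_aux: "x * (x - 1) * z + (1 - 2 * c) * (x * z) + c\<^sup>2 * z = (x - c)\<^sup>2 * z" for x z :: real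
    by (simp add: power2_eq_square algebra_simps)
  have "(\<lambda>k. real k * (real k - 1) * ?p k + (1 - 2 * c) * (real k * ?p k) + c\<^sup>2 * ?p k)
          sums (y * y + (1 - 2 * c) * y + c\<^sup>2 * 1)"
    by (intro sums_add sums_mult p0 p1 p2)
  moreover have "real k * (real k - 1) * ?p k + (1 - 2 * c) * (real k * ?p k) + c\<^sup>2 * ?p k
      = (real k - c)\<^sup>2 * ?p k" for k
    by (simp only: sq_aux)
  moreover have "y * y + (1 - 2 * c) * y + c\<^sup>2 * 1 = y + (y - c)\<^sup>2"
    by (simp add: power2_eq_square algebra_simps)
  ultimately show "(\<lambda>k. (real k - c)\<^sup>2 * ?p k) sums (y + (y - c)\<^sup>2)"
    by (simp only:)
qed

lemma (in prob_space) nn_integral_nat_valued: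
  assumes [measurable]: "N \<in> borel_measurable M"
    and "\<And>\<omega>. \<omega> \<in> space M \<Longrightarrow> N \<omega> \<in> \<nat>"
  shows "(\<integral>\<^sup>+\<omega>. f (N \<omega>) \<partial>M) = (\<Sum>k. f (real k) * ennreal (prob {\<omega> \<in> space M. N \<omega> = real k}))"
proof -
  have "(\<integral>\<^sup>+\<omega>. f (N \<omega>) \<partial>M) =
      (\<integral>\<^sup>+\<omega>. (\<Sum>k. f (real k) * indicator {\<omega> \<in> space M. N \<omega> = real k} \<omega>) \<partial>M)"
  proof (rule nn_integral_cong)
    fix \<omega> assume w: "\<omega> \<in> space M"
    then obtain n where n: "N \<omega> = real n"
      using assms(2) by (metis Nats_cases)
    have "(\<Sum>k. f (real k) * indicator {\<omega> \<in> space M. N \<omega> = real k} \<omega>) =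
        (\<Sum>k\<in>{n}. f (real k) * indicator {\<omega> \<in> space M. N \<omega> = real k} \<omega>)"
      by (rule suminf_finite) (use n in auto)
    then show "f (N \<omega>) = (\<Sum>k. f (real k) * indicator {\<omega> \<in> space M. N \<omega> = real k} \<omega>)"
      using w n by simp
  qed
  also have "\<dots> = (\<Sum>k. f (real k) * ennreal (prob {\<omega> \<in> space M. N \<omega> = real k}))"
    by (subst nn_integral_suminf) (simp_all add: nn_integral_cmult_indicator emeasure_eq_measure)
  finally show ?thesis .
qed

lemma poisson_process_moments:
  assumes "prob_space P" and N: "poisson_process P r N" and "0 < r" and y: "0 \<le> y"
  shows "(\<integral>\<^sup>+\<omega>. ennreal (N y \<omega>) \<partial>P) = ennreal (r * y)"
    and "(\<integral>\<^sup>+\<omega>. ennreal ((N y \<omega> - c)\<^sup>2) \<partial>P) = ennreal (r * y + (r * y - c)\<^sup>2)"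
proof -
  interpret prob_space P by fact
  let ?p = "\<lambda>k. (r * y) ^ k / fact k * exp (- (r * y))"
  have m: "N y \<in> borel_measurable P"
    and nat: "\<And>\<omega>. \<omega> \<in> space P \<Longrightarrow> N y \<omega> \<in> \<nat>"
    and p: "\<And>k. prob {\<omega> \<in> space P. N y \<omega> = real k} = ?p k"
    using N y by (auto simp: poisson_process_def subordinator_def levy_process_def)
  have p_nonneg: "0 \<le> ?p k" for k
    using \<open>0 < r\<close> y by simp
  have E: "(\<integral>\<^sup>+\<omega>. ennreal (f (N y \<omega>)) \<partial>P) = ennreal m"
    if f: "\<And>k. 0 \<le> f (real k)" and sums: "(\<lambda>k. f (real k) * ?p k) sums m" for f m
  proof -
    have "(\<integral>\<^sup>+\<omega>. ennreal (f (N y \<omega>)) \<partial>P) = (\<Sum>k. ennreal (f (real k)) * ennreal (?p k))"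
      using nn_integral_nat_valued[OF m nat, of "\<lambda>x. ennreal (f x)"] p by simp
    also have "\<dots> = (\<Sum>k. ennreal (f (real k) * ?p k))"
      using f p_nonneg by (simp only: ennreal_mult)
    also have "\<dots> = ennreal m"
      by (rule suminf_ennreal_eq[OF mult_nonneg_nonneg[OF f p_nonneg] sums])
    finally show ?thesis .
  qed
  show "(\<integral>\<^sup>+\<omega>. ennreal (N y \<omega>) \<partial>P) = ennreal (r * y)"
    using E[of "\<lambda>x. x", OF _ sums_poisson_moments(1)] by simp
  show "(\<integral>\<^sup>+\<omega>. ennreal ((N y \<omega> - c)\<^sup>2) \<partial>P) = ennreal (r * y + (r * y - c)\<^sup>2)"
    using E[of "\<lambda>x. (x - c)\<^sup>2", OF _ sums_poisson_moments(2)] by simp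
qed

section \<open>Paths of the inverse subordinator\<close>

lemma inverse_subordinator_nonneg: "0 \<le> inverse_subordinator S t \<omega>"
  by (auto simp: inverse_subordinator_def intro!: cInf_greatest)

lemma le_level_before_passage:
  assumes "x < inverse_subordinator S t \<omega>" and "0 \<le> x"
  shows "S x \<omega> \<le> t"
proof (rule ccontr)
  assume "\<not> S x \<omega> \<le> t"
  with assms(2) have "inverse_subordinator S t \<omega> \<le> x"
    by (auto simp: inverse_subordinator_def intro!: cInf_lower bdd_belowI[of _ 0])
  with assms(1) show False by simp
qed

lemma above_level_after_passage:
  assumes mono: "mono_on {0..} (\<lambda>t. S t \<omega>)"
    and "\<exists>r\<ge>0. t < S r \<omega>"
    and x: "inverse_subordinator S t \<omega> < x"
  shows "t < S x \<omega>"
proof -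
  have "Inf {r. 0 \<le> r \<and> S r \<omega> > t} < x" "{r. 0 \<le> r \<and> S r \<omega> > t} \<noteq> {}"
    using assms(2) x by (auto simp: inverse_subordinator_def)
  from cInf_lessD[OF this(2,1)] obtain r where "0 \<le> r" "t < S r \<omega>" "r < x"
    by auto
  then show ?thesis
    using monotone_onD[OF mono, of r x] by simp
qed

text \<open>
  If the path exceeds the level \<open>t\<close> somewhere, then a value \<open>x\<close> just above the passage time has
  \<open>t < S x\<close>, and all levels below \<open>S x\<close> are passed by time \<open>x\<close>. On a path bounded by \<open>t\<close> the default
  value 0 is taken at \<open>t\<close> and at all later levels, so right-continuity holds there as well. The second
  claim is local because the default value can make the passage time drop from a positive value to 0.
\<close>

lemma inverse_subordinator_right:
  assumes mono: "mono_on {0..} (\<lambda>t. S t \<omega>)"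
  shows "continuous (at_right t) (\<lambda>s. inverse_subordinator S s \<omega>)"
    and "\<forall>\<^sub>F s in at_right t. inverse_subordinator S t \<omega> \<le> inverse_subordinator S s \<omega>"
proof -
  let ?E = "\<lambda>s. inverse_subordinator S s \<omega>"
  have "(?E \<longlongrightarrow> ?E t) (at_right t) \<and> (\<forall>\<^sub>F s in at_right t. ?E t \<le> ?E s)"
  proof (cases "\<exists>r\<ge>0. t < S r \<omega>")
    case False
    then have "?E s = ?E t" if "t < s" for s
      using that by (fastforce simp: inverse_subordinator_def)
    then have eq: "\<forall>\<^sub>F s in at_right t. ?E s = ?E t"
      by (auto simp: eventually_at_filter)
    then show ?thesis
      by (auto intro: tendsto_eventually elim: eventually_mono)
  next
    case True
    have near: "\<forall>\<^sub>F s in at_right t. ?E t \<le> ?E s \<and> ?E s \<le> x" if "?E t < x" for x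
    proof -
      have x: "t < S x \<omega>" "0 \<le> x"
        using above_level_after_passage[OF mono True that] that
          inverse_subordinator_nonneg[of S t \<omega>] by auto
      have "?E t \<le> ?E s \<and> ?E s \<le> x" if s: "t < s" "s < S x \<omega>" for s
      proof
        show "?E s \<le> x"
          using le_level_before_passage[of x S s \<omega>] x s by linarith
        show "?E t \<le> ?E s"
        proof (rule ccontr)
          assume "\<not> ?E t \<le> ?E s"
          then obtain y where y: "?E s < y" "y < ?E t"
            using dense by (meson not_le)
          have "s < S y \<omega>"
            using above_level_after_passage[OF mono _ y(1)] x s by blast
          moreover have "S y \<omega> \<le> t"
            using le_level_before_passage[OF y(2)] y inverse_subordinator_nonneg[of S s \<omega>] by simp
          ultimately show False
            using s by simp
        qed
      qed
      then show ?thesis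
        using x(1) by (auto simp: eventually_at_right_field)
    qed
    have up: "\<forall>\<^sub>F s in at_right t. ?E t \<le> ?E s"
      using near[of "?E t + 1"] by (auto elim: eventually_mono)
    have "(?E \<longlongrightarrow> ?E t) (at_right t)"
    proof (rule order_tendstoI)
      fix a assume "a < ?E t"
      then show "\<forall>\<^sub>F s in at_right t. a < ?E s"
        using up by (auto elim: eventually_mono)
    next
      fix a assume "?E t < a"
      then obtain b where "?E t < b" "b < a"
        using dense by blast
      then show "\<forall>\<^sub>F s in at_right t. ?E s < a"
        using near[of b] by (auto elim: eventually_mono)
    qed
    with up show ?thesis by simp
  qed
  then show "continuous (at_right t) ?E" "\<forall>\<^sub>F s in at_right t. ?E t \<le> ?E s"
    by (simp_all add: continuous_within)
qed

lemma right_continuous_inverse_subordinator: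
  assumes "subordinator P S"
  shows "right_continuous_paths P (inverse_subordinator S)"
  unfolding right_continuous_paths_def
proof (intro ballI allI impI)
  fix \<omega> t assume "\<omega> \<in> space P"
  then have "mono_on {0..} (\<lambda>t. S t \<omega>)"
    using assms by (simp add: subordinator_def)
  then show "continuous (at_right t) (\<lambda>s. inverse_subordinator S s \<omega>)"
    by (rule inverse_subordinator_right(1))
qed

text \<open>
  The inner time approaches its limit from the right or stays there, so one-sided continuity of \<open>N\<close>
  is enough.
\<close>

lemma right_continuous_fpp:
  assumes "subordinator P S" and "right_continuous_paths P N"
  shows "right_continuous_paths P (fpp N S)"
  unfolding right_continuous_paths_def
proof (intro ballI allI impI)
  fix \<omega> t assume w: "\<omega> \<in> space P" and "0 \<le> (t::real)"
  let ?E = "\<lambda>s. inverse_subordinator S s \<omega>"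
  have mono: "mono_on {0..} (\<lambda>t. S t \<omega>)"
    using assms(1) w by (simp add: subordinator_def)
  have "continuous (at (?E t) within {?E t..}) (\<lambda>x. N x \<omega>)"
    using assms(2) w inverse_subordinator_nonneg[of S t \<omega>]
    by (simp add: right_continuous_paths_def at_within_Ici_at_right)
  then have "((\<lambda>s. N (?E s) \<omega>) \<longlongrightarrow> N (?E t) \<omega>) (at_right t)"
  proof (rule continuous_within_tendsto_compose)
    show "(?E \<longlongrightarrow> ?E t) (at_right t)"
      using inverse_subordinator_right(1)[where S = S, OF mono] by (simp add: continuous_within)
    show "\<forall>\<^sub>F s in at_right t. ?E s \<in> {?E t..}"
      using inverse_subordinator_right(2)[where S = S, OF mono] by simp
  qed
  then show "continuous (at_right t) (\<lambda>s. fpp N S s \<omega>)"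
    by (simp add: continuous_within fpp_def time_change_def)
qed

section \<open>The inverse stable subordinator\<close>

lemma subordinator_nonneg:
  assumes "subordinator P X" and "\<omega> \<in> space P" and "0 \<le> t"
  shows "0 \<le> X t \<omega>"
  using assms monotone_onD[of "{0..}" "(\<le>)" "(\<le>)" "\<lambda>t. X t \<omega>" 0 t]
  by (auto simp: subordinator_def levy_process_def)

lemma subordinator_measurable:
  assumes "subordinator P X" and "0 \<le> t"
  shows "X t \<in> borel_measurable P"
  using assms by (auto simp: subordinator_def levy_process_def)

lemma (in prob_space) integrable_exp_subordinator:
  assumes X: "subordinator M X" and "0 \<le> t" "0 \<le> u"
  shows "integrable M (\<lambda>\<omega>. exp (- u * X t \<omega>))"
proof (rule integrable_const_bound[where B = 1])
  show "AE \<omega> in M. norm (exp (- u * X t \<omega>)) \<le> 1"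
    using subordinator_nonneg[OF X] assms by auto
qed (use subordinator_measurable[OF X] assms in measurable)

lemma (in prob_space) nn_integral_exp_subordinator:
  assumes X: "subordinator M X" and "0 \<le> t" "0 \<le> u"
  shows "(\<integral>\<^sup>+\<omega>. ennreal (exp (- u * X t \<omega>)) \<partial>M) = ennreal (\<integral>\<omega>. exp (- u * X t \<omega>) \<partial>M)"
  using integrable_exp_subordinator[OF assms] by (rule nn_integral_eq_integral) simp

text \<open>
  A pathwise Chernoff bound: before the passage time the path stays below \<open>s\<close>, so each grid point
  \<open>k * h\<close> before it contributes at least \<open>exp (- u * s)\<close> to the series, and about \<open>E / h\<close> grid points
  lie there.
\<close>

lemma inverse_subordinator_le_suminf:
  assumes "0 < h" "0 \<le> u"
  shows "ennreal (inverse_subordinator S s \<omega>) \<le>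
    ennreal (h * exp (u * s)) * (\<Sum>k. ennreal (exp (- u * S (real k * h) \<omega>)))"
proof -
  let ?E = "inverse_subordinator S s \<omega>"
  define n where "n = nat \<lceil>?E / h\<rceil>"
  have E: "?E \<le> real n * h"
  proof -
    have "?E / h \<le> real n" unfolding n_def by linarith
    then show ?thesis using assms by (simp add: field_simps)
  qed
  have each: "exp (- u * s) \<le> exp (- u * S (real k * h) \<omega>)" if "k < n" for k
  proof -
    have "real k < ?E / h" using that unfolding n_def by linarith
    then have "real k * h < ?E" using assms by (simp add: field_simps)
    then have "S (real k * h) \<omega> \<le> s"
      by (rule le_level_before_passage) (use assms in simp)
    then show ?thesis
      using assms by (simp add: mult_left_mono)
  qed
  have "ennreal (real n * exp (- u * s)) \<le> (\<Sum>k<n. ennreal (exp (- u * S (real k * h) \<omega>)))"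
  proof -
    have "real n * exp (- u * s) = (\<Sum>k<n. exp (- u * s))" by simp
    also have "\<dots> \<le> (\<Sum>k<n. exp (- u * S (real k * h) \<omega>))"
      using each by (intro sum_mono) auto
    finally show ?thesis
      by (simp add: ennreal_leI)
  qed
  also have "\<dots> \<le> (\<Sum>k. ennreal (exp (- u * S (real k * h) \<omega>)))"
    by (rule sum_le_suminf) auto
  finally have "ennreal (h * exp (u * s)) * ennreal (real n * exp (- u * s)) \<le>
      ennreal (h * exp (u * s)) * (\<Sum>k. ennreal (exp (- u * S (real k * h) \<omega>)))"
    by (rule mult_left_mono) simp
  moreover have "ennreal (h * exp (u * s)) * ennreal (real n * exp (- u * s)) = ennreal (real n * h)"
  proof -
    have "h * exp (u * s) * (real n * exp (- u * s)) = real n * h * exp (u * s + - u * s)"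
      by (simp only: exp_add mult_ac)
    then have "h * exp (u * s) * (real n * exp (- u * s)) = real n * h"
      by simp
    then show ?thesis
      using assms by (subst ennreal_mult[symmetric]) auto
  qed
  moreover have "ennreal ?E \<le> ennreal (real n * h)"
    using E by (rule ennreal_leI)
  ultimately show ?thesis
    by (simp only: order_trans)
qed

text \<open>
  With \<open>u = 1 / (1 + s)\<close> and \<open>h = u powr - \<beta>\<close> the expectation of the series above is geometric with
  ratio \<open>exp (- 1)\<close>, and the scaling \<open>h\<close> gives the growth exponent \<open>\<beta>\<close>. Shifting \<open>s\<close> by 1 makes the
  bound uniform near 0.
\<close>

lemma inverse_stable_mean_bound:
  assumes "prob_space P" and S: "stable_subordinator P \<beta> S"
    and meas: "inverse_subordinator S s \<in> borel_measurable P" and "0 \<le> s"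
  shows "(\<integral>\<^sup>+\<omega>. ennreal (inverse_subordinator S s \<omega>) \<partial>P) \<le>
    ennreal (exp 1 / (1 - exp (- 1)) * (1 + s) powr \<beta>)"
proof -
  interpret prob_space P by fact
  have sub: "subordinator P S"
    using S by (simp add: stable_subordinator_def)
  define h where "h = (1 + s) powr \<beta>"
  define u where "u = 1 / (1 + s)"
  have h: "0 < h" and u: "0 \<le> u" and us: "u * s \<le> 1" and hu: "h * u powr \<beta> = 1"
    using \<open>0 \<le> s\<close> by (simp_all add: h_def u_def powr_divide field_simps)
  have [measurable]: "S (real k * h) \<in> borel_measurable P" for k
    using subordinator_measurable[OF sub] h by simp
  have each: "(\<integral>\<^sup>+\<omega>. ennreal (exp (- u * S (real k * h) \<omega>)) \<partial>P) = ennreal (exp (- 1) ^ k)" for k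
  proof -
    have "(\<integral>\<omega>. exp (- u * S (real k * h) \<omega>) \<partial>P) = exp (- (real k * h) * u powr \<beta>)"
      using S h u by (simp add: stable_subordinator_def)
    also have "\<dots> = exp (real k * (- 1))"
      using hu by (simp add: mult.assoc)
    finally show ?thesis
      using nn_integral_exp_subordinator[OF sub _ u, of "real k * h"] h
        exp_of_nat_mult[of k "- 1 :: real"] by simp
  qed
  have "(\<integral>\<^sup>+\<omega>. ennreal (inverse_subordinator S s \<omega>) \<partial>P) \<le>
      (\<integral>\<^sup>+\<omega>. ennreal (h * exp (u * s)) * (\<Sum>k. ennreal (exp (- u * S (real k * h) \<omega>))) \<partial>P)"
    by (intro nn_integral_mono inverse_subordinator_le_suminf h u)
  also have "\<dots> = ennreal (h * exp (u * s)) * (\<Sum>k. ennreal (exp (- 1) ^ k))"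
    unfolding each[symmetric] by (subst nn_integral_cmult, measurable) (subst nn_integral_suminf, simp_all)
  also have "(\<Sum>k. ennreal (exp (- 1) ^ k)) = ennreal (1 / (1 - exp (- 1)))"
    by (intro suminf_ennreal_eq geometric_sums) auto
  also have "ennreal (h * exp (u * s)) * \<dots> = ennreal (exp (u * s) * (h / (1 - exp (- 1))))"
    using h by (subst ennreal_mult[symmetric]) (auto simp: mult_ac)
  also have "\<dots> \<le> ennreal (exp 1 * (h / (1 - exp (- 1))))"
    using us h by (intro ennreal_leI mult_right_mono) auto
  finally show ?thesis
    by (simp add: h_def)
qed

text \<open>
  If the passage time of level \<open>s\<close> were a constant \<open>c > 0\<close>, then \<open>S (c / 2)\<close> would be bounded by \<open>s\<close>;
  its Laplace transform would then be at least \<open>exp (- u * s)\<close>, whereas \<open>exp (- (c / 2) * u powr \<beta>)\<close>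
  is smaller for small \<open>u\<close> because \<open>\<beta> < 1\<close>. If it were 0, then \<open>S\<close> would jump above \<open>s\<close> immediately,
  or never pass it, and the latter is excluded by letting time tend to infinity; but
  \<open>exp (- S (s / 2))\<close> has expectation \<open>exp (- s / 2) > exp (- s)\<close>.
\<close>

lemma inverse_stable_not_AE_const:
  assumes "prob_space P" and S: "stable_subordinator P \<beta> S" and \<beta>: "\<beta> < 1" and s: "0 < s"
  shows "\<not> (AE \<omega> in P. inverse_subordinator S s \<omega> = c)"
proof
  interpret prob_space P by fact
  assume const: "AE \<omega> in P. inverse_subordinator S s \<omega> = c"
  have sub: "subordinator P S"
    and L: "\<And>t u. 0 \<le> t \<Longrightarrow> 0 \<le> u \<Longrightarrow> (\<integral>\<omega>. exp (- u * S t \<omega>) \<partial>P) = exp (- t * u powr \<beta>)"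
    using S by (simp_all add: stable_subordinator_def)
  show False
  proof (cases "0 < c")
    case True
    define x where "x = c / 2"
    \<comment> \<open>Chosen such that \<open>u * s\<close> is half of \<open>x * u powr \<beta>\<close>.\<close>
    define u where "u = (x / (2 * s)) powr (1 / (1 - \<beta>))"
    have x: "0 < x" "x < c" and u: "0 < u"
      using True s by (auto simp: x_def u_def)
    have "exp (- u * s) \<le> (\<integral>\<omega>. exp (- u * S x \<omega>) \<partial>P)"
    proof (rule integral_ge_const)
      show "integrable P (\<lambda>\<omega>. exp (- u * S x \<omega>))"
        using integrable_exp_subordinator[OF sub, of x u] x u by simp
      show "AE \<omega> in P. exp (- u * s) \<le> exp (- u * S x \<omega>)"
        using const
      proof eventually_elim
        case (elim \<omega>)
        then have "S x \<omega> \<le> s"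
          using x by (intro le_level_before_passage[of x S s \<omega>]) simp_all
        then show ?case
          using u by simp
      qed
    qed
    then have le: "x * u powr \<beta> \<le> u * s"
      using L[of x u] x u by simp
    have "u = u powr \<beta> * u powr (1 - \<beta>)"
      using u by (simp add: powr_add[symmetric])
    also have "u powr (1 - \<beta>) = x / (2 * s)"
      using \<beta> x s by (simp add: u_def powr_powr)
    finally have "u * s = x * u powr \<beta> / 2"
      using s by (simp add: field_simps)
    moreover have "0 < x * u powr \<beta>"
      using x u by simp
    ultimately show False
      using le by linarith
  next
    case False
    have "exp (- s / 2) \<le> exp (- s) + exp s * exp (- 1) ^ n" for n :: nat
    proof -
      have int: "integrable P (\<lambda>\<omega>. exp (- 1 * S t \<omega>))" if "0 \<le> t" for t
        using integrable_exp_subordinator[OF sub that, of 1] by simp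
      have "(\<integral>\<omega>. exp (- 1 * S (s / 2) \<omega>) \<partial>P) \<le>
          (\<integral>\<omega>. exp (- s) + exp s * exp (- 1 * S (real n) \<omega>) \<partial>P)"
      proof (rule integral_mono_AE)
        show "AE \<omega> in P. exp (- 1 * S (s / 2) \<omega>) \<le> exp (- s) + exp s * exp (- 1 * S (real n) \<omega>)"
          using const AE_space
        proof eventually_elim
          case (elim \<omega>)
          have mono: "mono_on {0..} (\<lambda>t. S t \<omega>)"
            using sub elim by (simp add: subordinator_def)
          have E: "inverse_subordinator S s \<omega> < s / 2"
            using elim False s by simp
          show ?case
          proof (cases "s < S (s / 2) \<omega>")
            case True
            then have "exp (- 1 * S (s / 2) \<omega>) \<le> exp (- s)" by simp
            then show ?thesis by (simp add: add_increasing2)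
          next
            \<comment> \<open>The passage time is 0 by default: the level \<open>s\<close> is never exceeded.\<close>
            case low: False
            then have "\<not> (\<exists>r\<ge>0. s < S r \<omega>)"
              using above_level_after_passage[where S = S, OF mono _ E] by blast
            then have "S (real n) \<omega> \<le> s"
              by (meson not_le of_nat_0_le_iff)
            then have "1 \<le> exp (s + - 1 * S (real n) \<omega>)" by simp
            moreover have "exp (- 1 * S (s / 2) \<omega>) \<le> 1"
              using subordinator_nonneg[OF sub, of \<omega> "s / 2"] elim s by simp
            ultimately have "exp (- 1 * S (s / 2) \<omega>) \<le> exp s * exp (- 1 * S (real n) \<omega>)"
              by (simp only: exp_add[symmetric] order_trans)
            then show ?thesis by (simp add: add_increasing)
          qed
        qed
      qed (use int s in auto)
      also have "\<dots> = exp (- s) + exp s * (\<integral>\<omega>. exp (- 1 * S (real n) \<omega>) \<partial>P)"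
        using int[of "real n"] by (simp add: prob_space)
      finally show ?thesis
        using L[of "s / 2" 1] L[of "real n" 1] s exp_of_nat_mult[of n "- 1 :: real"] by simp
    qed
    moreover have "(\<lambda>n. exp (- s) + exp s * exp (- 1) ^ n) \<longlonglongrightarrow> exp (- s) + exp s * 0"
      by (intro tendsto_intros LIMSEQ_realpow_zero) auto
    ultimately have "exp (- s / 2) \<le> exp (- s) + exp s * 0"
      by (intro LIMSEQ_le_const) auto
    then show False
      using s by simp
  qed
qed

section \<open>The Mittag-Leffler subordinator\<close>

text \<open>
  Bounds a power by functions whose expectations are read off the Laplace transform: for
  \<open>x \<ge> 1\<close> and \<open>2 ^ k \<le> x < 2 ^ (k + 1)\<close> the \<open>k\<close>-th term alone is comparable to \<open>(1 + x) powr \<beta>\<close>.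
\<close>

lemma powr_le_suminf_exp:
  assumes "0 < \<beta>" and "0 \<le> x"
  shows "ennreal ((1 + x) powr \<beta>) \<le> ennreal (2 powr \<beta>) +
    ennreal (4 powr \<beta> / (1 - exp (- 1))) *
      (\<Sum>k. ennreal ((2 ^ k) powr \<beta> * (1 - exp (- ((1 / 2) ^ k) * x))))"
    (is "_ \<le> _ + ennreal ?K * (\<Sum>k. ennreal (?a k))")
proof (cases "x < 1")
  case True
  then have "(1 + x) powr \<beta> \<le> 2 powr \<beta>"
    using assms by (intro powr_mono2) auto
  then show ?thesis
    by (intro add_increasing2 ennreal_leI) auto
next
  case False
  then have "1 \<le> nat \<lfloor>x\<rfloor>"
    by linarith
  then obtain k where "2 ^ k \<le> nat \<lfloor>x\<rfloor>" "nat \<lfloor>x\<rfloor> + 1 \<le> 2 ^ (k + 1)"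
    using ex_power_ivl1[of 2 "nat \<lfloor>x\<rfloor>"] by auto
  then have "real (2 ^ k) \<le> real (nat \<lfloor>x\<rfloor>)" "real (nat \<lfloor>x\<rfloor> + 1) \<le> real (2 ^ (k + 1))"
    by (simp_all only: of_nat_le_iff)
  moreover have "real (nat \<lfloor>x\<rfloor>) \<le> x" "x < real (nat \<lfloor>x\<rfloor> + 1)"
    using False by linarith+
  ultimately have "real (2 ^ k) \<le> x" "x < real (2 ^ (k + 1))"
    by linarith+
  then have k: "2 ^ k \<le> x" "x < 2 ^ (k + 1)"
    by simp_all
  have "1 \<le> (1 / 2) ^ k * x"
    using k(1) by (simp add: field_simps)
  then have "exp (- ((1 / 2) ^ k) * x) \<le> exp (- 1)"
    by (simp only: exp_le_cancel_iff)
  then have a: "(2 ^ k) powr \<beta> * (1 - exp (- 1)) \<le> ?a k"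
    by (intro mult_left_mono) auto
  have "(1 + x) powr \<beta> \<le> (4 * 2 ^ k) powr \<beta>"
    using k False assms by (intro powr_mono2) auto
  also have "\<dots> = ?K * ((2 ^ k) powr \<beta> * (1 - exp (- 1)))"
    by (simp add: powr_mult)
  also have "\<dots> \<le> ?K * ?a k"
    using a by (intro mult_left_mono) auto
  finally have "ennreal ((1 + x) powr \<beta>) \<le> ennreal (?K * ?a k)"
    by (rule ennreal_leI)
  also have "\<dots> = ennreal ?K * ennreal (?a k)"
    by (rule ennreal_mult') simp
  also have "\<dots> \<le> ennreal ?K * (\<Sum>k. ennreal (?a k))"
  proof (rule mult_left_mono)
    show "ennreal (?a k) \<le> (\<Sum>k. ennreal (?a k))"
      using sum_le_suminf[of "\<lambda>k. ennreal (?a k)" "{k}"] by simp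
  qed simp
  finally show ?thesis
    by (rule add_increasing[rotated]) simp
qed

lemma mittag_leffler_transform_bound:
  fixes \<mu> a y :: real
  assumes "0 < \<mu>" "0 \<le> a" "0 \<le> y"
  shows "1 - (\<mu> / (\<mu> + y)) powr a \<le> a * y / \<mu>"
proof -
  have "ln (1 + y / \<mu>) \<le> y / \<mu>"
    using assms by (intro ln_add_one_self_le_self) simp
  moreover have "ln (\<mu> / (\<mu> + y)) = - ln (1 + y / \<mu>)"
    using assms by (simp add: ln_div[symmetric] add_divide_distrib[symmetric] ln_div field_simps)
  ultimately have "a * - (y / \<mu>) \<le> a * ln (\<mu> / (\<mu> + y))"
    using assms by (intro mult_left_mono) auto
  moreover have "1 + a * ln (\<mu> / (\<mu> + y)) \<le> (\<mu> / (\<mu> + y)) powr a"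
    using assms exp_ge_add_one_self[of "a * ln (\<mu> / (\<mu> + y))"] by (simp add: powr_def)
  ultimately show ?thesis
    by simp
qed

text \<open>
  One minus the Laplace transform at \<open>u\<close> is of order \<open>u powr \<alpha>\<close>. The expectation of the \<open>k\<close>-th dyadic
  term is therefore of order \<open>2 powr (k * (\<beta> - \<alpha>))\<close>; this is where \<open>\<beta> < \<alpha>\<close> is used.
\<close>

lemma mittag_leffler_moment_finite:
  assumes "prob_space P" and M: "mittag_leffler_subordinator P \<alpha> \<rho> \<mu> M"
    and "0 < \<beta>" "\<beta> < \<alpha>" "0 < \<rho>" "0 < \<mu>" "0 \<le> t"
  shows "(\<integral>\<^sup>+\<omega>. ennreal ((1 + M t \<omega>) powr \<beta>) \<partial>P) < \<infinity>"
proof -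
  interpret prob_space P by fact
  have sub: "subordinator P M"
    using M by (simp add: mittag_leffler_subordinator_def)
  have [measurable]: "M t \<in> borel_measurable P"
    using subordinator_measurable[OF sub] assms by simp
  let ?a = "\<lambda>k \<omega>. (2 ^ k) powr \<beta> * (1 - exp (- ((1 / 2) ^ k) * M t \<omega>))"
  let ?K = "4 powr \<beta> / (1 - exp (- 1)) :: real"
  let ?q = "2 powr (\<beta> - \<alpha>)"
  have each: "(\<integral>\<^sup>+\<omega>. ennreal (?a k \<omega>) \<partial>P) \<le> ennreal (\<rho> * t / \<mu> * ?q ^ k)" for k :: nat
  proof -
    let ?u = "(1 / 2) ^ k :: real"
    have int: "integrable P (\<lambda>\<omega>. exp (- ?u * M t \<omega>))"
      using integrable_exp_subordinator[OF sub, of t ?u] assms by simp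
    have "(\<integral>\<^sup>+\<omega>. ennreal (?a k \<omega>) \<partial>P) = ennreal (\<integral>\<omega>. ?a k \<omega> \<partial>P)"
    proof (rule nn_integral_eq_integral)
      show "integrable P (?a k)"
        using int by simp
      show "AE \<omega> in P. 0 \<le> ?a k \<omega>"
        using subordinator_nonneg[OF sub, of _ t] assms by (auto intro!: mult_nonneg_nonneg)
    qed
    also have "(\<integral>\<omega>. ?a k \<omega> \<partial>P) = (2 ^ k) powr \<beta> * (1 - (\<integral>\<omega>. exp (- ?u * M t \<omega>) \<partial>P))"
      using int by (simp add: prob_space)
    also have "(\<integral>\<omega>. exp (- ?u * M t \<omega>) \<partial>P) = (\<mu> / (\<mu> + ?u powr \<alpha>)) powr (\<rho> * t)"
      using M assms unfolding mittag_leffler_subordinator_def by simp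
    also have "(2 ^ k) powr \<beta> * (1 - \<dots>) \<le> (2 ^ k) powr \<beta> * (\<rho> * t * ?u powr \<alpha> / \<mu>)"
      using assms by (intro mult_left_mono mittag_leffler_transform_bound) auto
    also have "\<dots> = \<rho> * t / \<mu> * ((2 ^ k) powr \<beta> * ?u powr \<alpha>)"
      by simp
    also have "(2 ^ k) powr \<beta> * ?u powr \<alpha> = ?q ^ k"
      by (simp add: powr_realpow[symmetric] powr_powr powr_divide powr_diff[symmetric] 
          power_one_over algebra_simps)
    finally show ?thesis
      by (simp add: ennreal_leI)
  qed
  have "(\<integral>\<^sup>+\<omega>. ennreal ((1 + M t \<omega>) powr \<beta>) \<partial>P) \<le>
      (\<integral>\<^sup>+\<omega>. ennreal (2 powr \<beta>) + ennreal ?K * (\<Sum>k. ennreal (?a k \<omega>)) \<partial>P)"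
    using assms subordinator_nonneg[OF sub] by (intro nn_integral_mono powr_le_suminf_exp) auto
  also have "\<dots> = ennreal (2 powr \<beta>) + ennreal ?K * (\<Sum>k. \<integral>\<^sup>+\<omega>. ennreal (?a k \<omega>) \<partial>P)"
    by (simp add: nn_integral_add nn_integral_cmult nn_integral_suminf emeasure_space_1)
  also have "\<dots> \<le> ennreal (2 powr \<beta>) + ennreal ?K * (\<Sum>k. ennreal (\<rho> * t / \<mu> * ?q ^ k))"
    using each by (intro add_mono mult_left_mono suminf_le) auto
  also have "(\<Sum>k. ennreal (\<rho> * t / \<mu> * ?q ^ k)) = ennreal (\<rho> * t / \<mu> * (1 / (1 - ?q)))"
  proof (rule suminf_ennreal_eq)
    have "?q < 2 powr 0"
      using assms by (intro powr_less_mono) auto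
    then show "(\<lambda>k. \<rho> * t / \<mu> * ?q ^ k) sums (\<rho> * t / \<mu> * (1 / (1 - ?q)))"
      by (intro sums_mult geometric_sums) auto
  qed (use assms in simp)
  also have "ennreal (2 powr \<beta>) + ennreal ?K * \<dots> < \<infinity>"
    by (simp add: ennreal_mult_less_top)
  finally show ?thesis .
qed

lemma mittag_leffler_not_AE_zero:
  assumes "prob_space P" and M: "mittag_leffler_subordinator P \<alpha> \<rho> \<mu> M"
    and "0 < \<rho>" "0 < \<mu>" "0 < t"
  shows "\<not> (AE \<omega> in P. M t \<omega> = 0)"
proof
  interpret prob_space P by fact
  have [measurable]: "M t \<in> borel_measurable P"
    using M assms subordinator_measurable[of P M t] by (simp add: mittag_leffler_subordinator_def)
  assume "AE \<omega> in P. M t \<omega> = 0"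
  then have "(\<integral>\<omega>. exp (- 1 * M t \<omega>) \<partial>P) = (\<integral>\<omega>. 1 \<partial>P)"
    by (intro integral_cong_AE) auto
  moreover have "(\<integral>\<omega>. exp (- 1 * M t \<omega>) \<partial>P) = (\<mu> / (\<mu> + 1 powr \<alpha>)) powr (\<rho> * t)"
    using M assms unfolding mittag_leffler_subordinator_def by (metis less_imp_le zero_le_one)
  moreover have "(\<mu> / (\<mu> + 1)) powr (\<rho> * t) < 1 powr (\<rho> * t)"
    using assms by (intro powr_less_mono2) auto
  ultimately show False
    by (simp add: prob_space)
qed

section \<open>Overdispersion\<close>

text \<open>
  Given the passage time, \<open>N\<close> is Poisson, which has variance equal to its mean. The randomness of
  the passage time adds the last term.
\<close>

lemma fpp_moments:
  assumes "prob_space P" and S: "subordinator P S" and N: "poisson_process P r N" and "0 < r"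
    and ind: "indep_processes P N (inverse_subordinator S)" and "0 \<le> s"
  shows "(\<integral>\<^sup>+\<omega>. ennreal (fpp N S s \<omega>) \<partial>P) =
      (\<integral>\<^sup>+\<omega>. ennreal (r * inverse_subordinator S s \<omega>) \<partial>P)"
    and "(\<integral>\<^sup>+\<omega>. ennreal ((fpp N S s \<omega> - c)\<^sup>2) \<partial>P) =
      (\<integral>\<^sup>+\<omega>. ennreal (r * inverse_subordinator S s \<omega>) \<partial>P) +
      (\<integral>\<^sup>+\<omega>. ennreal ((r * inverse_subordinator S s \<omega> - c)\<^sup>2) \<partial>P)"
proof -
  interpret prob_space P by fact
  let ?E = "inverse_subordinator S s"
  have [measurable]: "?E \<in> borel_measurable P"
    using indep_processes_measurable(2)[OF \<open>prob_space P\<close> ind] \<open>0 \<le> s\<close> by simp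
  have rc: "right_continuous_paths P N"
    using N by (simp add: poisson_process_def subordinator_def levy_process_def right_continuous_paths_def)
  note change = indep_time_change(2)[OF rc indep_processes_sym[OF \<open>prob_space P\<close> ind] \<open>0 \<le> s\<close>
      inverse_subordinator_nonneg]
  note moments = poisson_process_moments[OF \<open>prob_space P\<close> N \<open>0 < r\<close> inverse_subordinator_nonneg]
  show "(\<integral>\<^sup>+\<omega>. ennreal (fpp N S s \<omega>) \<partial>P) = (\<integral>\<^sup>+\<omega>. ennreal (r * ?E \<omega>) \<partial>P)"
    using change[of ennreal] by (simp add: fpp_def time_change_def moments)
  have "(\<integral>\<^sup>+\<omega>. ennreal ((fpp N S s \<omega> - c)\<^sup>2) \<partial>P) =
      (\<integral>\<^sup>+\<omega>. ennreal (r * ?E \<omega> + (r * ?E \<omega> - c)\<^sup>2) \<partial>P)"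
    using change[of "\<lambda>x. ennreal ((x - c)\<^sup>2)"] by (simp add: fpp_def time_change_def moments)
  also have "\<dots> = (\<integral>\<^sup>+\<omega>. ennreal (r * ?E \<omega>) + ennreal ((r * ?E \<omega> - c)\<^sup>2) \<partial>P)"
    using \<open>0 < r\<close> inverse_subordinator_nonneg[of S s] by (intro nn_integral_cong ennreal_plus) auto
  also have "\<dots> = (\<integral>\<^sup>+\<omega>. ennreal (r * ?E \<omega>) \<partial>P) + (\<integral>\<^sup>+\<omega>. ennreal ((r * ?E \<omega> - c)\<^sup>2) \<partial>P)"
    by (intro nn_integral_add) measurable
  finally show "(\<integral>\<^sup>+\<omega>. ennreal ((fpp N S s \<omega> - c)\<^sup>2) \<partial>P) =
      (\<integral>\<^sup>+\<omega>. ennreal (r * ?E \<omega>) \<partial>P) + (\<integral>\<^sup>+\<omega>. ennreal ((r * ?E \<omega> - c)\<^sup>2) \<partial>P)" .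
qed

text \<open>
  The excess \<open>\<delta>\<close> of variance over mean is an iterated integral of a square. It vanishes only if, at
  almost every value of \<open>M t\<close>, the passage time equals \<open>c / r\<close> almost surely; this forces \<open>M t\<close> to be
  0 almost surely.
\<close>

theorem mainTheorem4:
  fixes P :: "'a measure"
    and S M N :: "real \<Rightarrow> 'a \<Rightarrow> real"
    and \<alpha> \<beta> \<rho> \<mu> r :: real
  assumes "prob_space P"
    and "0 < \<alpha>" and "\<alpha> < 1" and "0 < \<rho>" and "0 < \<mu>" and "0 < r"
    and "0 < \<beta>" and "\<beta> < \<alpha>"
    and "stable_subordinator P \<beta> S"
    and "poisson_process P r N"
    and "indep_processes P N (inverse_subordinator S)"
    and "mittag_leffler_subordinator P \<alpha> \<rho> \<mu> M"
    and "indep_processes P M (fpp N S)"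
  shows "\<forall>t>0. integrable P (gfnbp N S M t) \<and>
           ext_variance P (gfnbp N S M t) - ereal (\<integral>\<omega>. gfnbp N S M t \<omega> \<partial>P) > 0"
proof (intro allI impI)
  fix t :: real
  assume t: "0 < t"
  interpret prob_space P by fact
  let ?E = "inverse_subordinator S" and ?G = "gfnbp N S M t"
  have S: "subordinator P S"
    using assms(9) by (simp add: stable_subordinator_def)
  have N: "subordinator P N"
    using assms(10) by (simp add: poisson_process_def)
  have M: "subordinator P M"
    using assms(12) by (simp add: mittag_leffler_subordinator_def)
  have Mt: "M t \<in> borel_measurable P" "\<And>\<omega>. \<omega> \<in> space P \<Longrightarrow> 0 \<le> M t \<omega>"
    using subordinator_measurable[OF M] subordinator_nonneg[OF M] t by auto
  note [measurable] = Mt(1)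
  have Es: "?E s \<in> borel_measurable P" if "0 \<le> s" for s
    using indep_processes_measurable(2)[OF assms(1,11) that] .
  have rcN: "right_continuous_paths P N"
    using N by (simp add: subordinator_def levy_process_def right_continuous_paths_def)
  note rcX = right_continuous_fpp[OF S rcN]
  note change = indep_time_change[OF rcX assms(13) less_imp_le[OF t] Mt(2)]
  have G_meas[measurable]: "?G \<in> borel_measurable P"
    using change(1) by (simp add: gfnbp_def time_change_def[abs_def])
  have G_change: "(\<integral>\<^sup>+\<omega>. f (?G \<omega>) \<partial>P) = (\<integral>\<^sup>+\<omega>'. \<integral>\<^sup>+\<omega>. f (fpp N S (M t \<omega>') \<omega>) \<partial>P \<partial>P)"
    if "f \<in> borel_measurable borel" for f
    using change(2)[OF _ that] by (simp add: gfnbp_def time_change_def)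
  have G_nonneg: "0 \<le> ?G \<omega>" if "\<omega> \<in> space P" for \<omega>
    using subordinator_nonneg[OF N that inverse_subordinator_nonneg]
    by (simp add: gfnbp_def fpp_def time_change_def)
  have [measurable]: "(\<lambda>(\<omega>', \<omega>). ?E (M t \<omega>') \<omega>) \<in> borel_measurable (P \<Otimes>\<^sub>M P)"
    by (rule measurable_process_pair[OF right_continuous_inverse_subordinator[OF S]
          indep_processes_measurable(1)[OF assms(1,11)] Mt])
  note moments = fpp_moments[OF assms(1) S assms(10,6,11) Mt(2)]
  have mean: "(\<integral>\<^sup>+\<omega>. ennreal (?G \<omega>) \<partial>P) = (\<integral>\<^sup>+\<omega>'. \<integral>\<^sup>+\<omega>. ennreal (r * ?E (M t \<omega>') \<omega>) \<partial>P \<partial>P)"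
    using G_change[of ennreal] moments(1) by (simp cong: nn_integral_cong)
  have "(\<integral>\<^sup>+\<omega>. ennreal (?G \<omega>) \<partial>P) < \<infinity>"
  proof -
    let ?K = "exp 1 / (1 - exp (- 1)) :: real"
    have "(\<integral>\<^sup>+\<omega>. ennreal (r * ?E (M t \<omega>') \<omega>) \<partial>P) \<le> ennreal (r * ?K) * ennreal ((1 + M t \<omega>') powr \<beta>)"
      if w: "\<omega>' \<in> space P" for \<omega>'
    proof -
      have "(\<integral>\<^sup>+\<omega>. ennreal (r * ?E (M t \<omega>') \<omega>) \<partial>P) = ennreal r * (\<integral>\<^sup>+\<omega>. ennreal (?E (M t \<omega>') \<omega>) \<partial>P)"
        using Es[OF Mt(2)[OF w]] assms(6) by (simp add: ennreal_mult' nn_integral_cmult)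
      also have "\<dots> \<le> ennreal r * ennreal (?K * (1 + M t \<omega>') powr \<beta>)"
        using inverse_stable_mean_bound[OF assms(1,9) Es[OF Mt(2)[OF w]] Mt(2)[OF w]]
        by (rule mult_left_mono) simp
      also have "\<dots> = ennreal (r * ?K) * ennreal ((1 + M t \<omega>') powr \<beta>)"
        using assms(6) by (simp add: ennreal_mult'[symmetric] ennreal_mult''[symmetric] mult_ac)
      finally show ?thesis .
    qed
    then have "(\<integral>\<^sup>+\<omega>. ennreal (?G \<omega>) \<partial>P) \<le>
        (\<integral>\<^sup>+\<omega>'. ennreal (r * ?K) * ennreal ((1 + M t \<omega>') powr \<beta>) \<partial>P)"
      unfolding mean by (rule nn_integral_mono)
    also have "\<dots> = ennreal (r * ?K) * (\<integral>\<^sup>+\<omega>'. ennreal ((1 + M t \<omega>') powr \<beta>) \<partial>P)"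
      by (rule nn_integral_cmult) measurable
    also have "\<dots> < \<infinity>"
      using mittag_leffler_moment_finite[OF assms(1,12,7,8,4,5) less_imp_le[OF t]]
      by (simp add: ennreal_mult_less_top)
    finally show ?thesis .
  qed
  then have G_int: "integrable P ?G"
    using G_nonneg by (intro integrableI_nonneg) auto
  define c where "c = (\<integral>\<omega>. ?G \<omega> \<partial>P)"
  have c: "(\<integral>\<^sup>+\<omega>. ennreal (?G \<omega>) \<partial>P) = ennreal c"
    unfolding c_def using G_int G_nonneg by (intro nn_integral_eq_integral) auto
  have "0 \<le> c"
    unfolding c_def using G_nonneg by (intro integral_nonneg_AE) auto
  define \<delta> where "\<delta> = (\<integral>\<^sup>+\<omega>'. \<integral>\<^sup>+\<omega>. ennreal ((r * ?E (M t \<omega>') \<omega> - c)\<^sup>2) \<partial>P \<partial>P)"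
  have var: "(\<integral>\<^sup>+\<omega>. ennreal ((?G \<omega> - c)\<^sup>2) \<partial>P) = ennreal c + \<delta>"
  proof -
    have "(\<integral>\<^sup>+\<omega>. ennreal ((?G \<omega> - c)\<^sup>2) \<partial>P) =
        (\<integral>\<^sup>+\<omega>'. (\<integral>\<^sup>+\<omega>. ennreal (r * ?E (M t \<omega>') \<omega>) \<partial>P) +
          (\<integral>\<^sup>+\<omega>. ennreal ((r * ?E (M t \<omega>') \<omega> - c)\<^sup>2) \<partial>P) \<partial>P)"
      using G_change[of "\<lambda>x. ennreal ((x - c)\<^sup>2)"] moments(2) by (simp cong: nn_integral_cong)
    also have "\<dots> = ennreal c + \<delta>"
      unfolding \<delta>_def c[symmetric] mean by (rule nn_integral_add) measurable
    finally show ?thesis .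
  qed
  have "\<delta> \<noteq> 0"
  proof
    assume "\<delta> = 0"
    then have "AE \<omega>' in P. (\<integral>\<^sup>+\<omega>. ennreal ((r * ?E (M t \<omega>') \<omega> - c)\<^sup>2) \<partial>P) = 0"
      unfolding \<delta>_def by (subst (asm) nn_integral_0_iff_AE) measurable
    then have "AE \<omega>' in P. M t \<omega>' = 0"
      using AE_space
    proof eventually_elim
      case (elim \<omega>')
      note [measurable] = Es[OF Mt(2)[OF elim(2)]]
      have "AE \<omega> in P. ennreal ((r * ?E (M t \<omega>') \<omega> - c)\<^sup>2) = 0"
        using elim(1) by (subst (asm) nn_integral_0_iff_AE) measurable
      then have "AE \<omega> in P. ?E (M t \<omega>') \<omega> = c / r"
        by eventually_elim (use assms(6) in \<open>simp add: field_simps\<close>)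
      then have "\<not> 0 < M t \<omega>'"
        using inverse_stable_not_AE_const[OF assms(1,9)] assms by auto
      then show ?case
        using Mt(2)[OF elim(2)] by simp
    qed
    then show False
      using mittag_leffler_not_AE_zero[OF assms(1,12,4,5) t] by contradiction
  qed
  have "0 < ext_variance P ?G - ereal c"
  proof (cases \<delta>)
    case (real d)
    then show ?thesis
      using \<open>\<delta> \<noteq> 0\<close> \<open>0 \<le> c\<close> unfolding ext_variance_def c_def[symmetric] var
      by (simp add: ennreal_plus[symmetric] del: ennreal_plus)
  next
    case top
    then show ?thesis
      unfolding ext_variance_def c_def[symmetric] var by simp
  qed
  with G_int show "integrable P ?G \<and> ext_variance P ?G - ereal (\<integral>\<omega>. ?G \<omega> \<partial>P) > 0"
    by (simp add: c_def)
qed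

end
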